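(* Let $K$ be a compact Hausdorff space and let $F\subset C(K)$ be a filtered subalgebra with filtration $\{0\}\subset F_0\subseteq F_1\subseteq\cdots\subseteq F_d\subseteq\cdots\subseteq F$ such that $n_d:=\dim F_d<\infty$ for all $d$ and $F_0$ contains the constant functions on $K$. Suppose $\{n_d\}_{d\in\mathbb N}$ grows at most polynomially in $d$, that is, there are $k,\hat c\in\mathbb R_+$ such that $n_d\le \hat c\, d^k$ for all $d\in\mathbb N$. Then for each natural number $s\ge 3$ there exist linear injective maps $i_{d,s}: F_d\hookrightarrow \ell^\infty_{N_{d,s}}$, $d\in\mathbb N$, where $$N_{d,s}:= \left\lfloor \hat c\,d^k\cdot s^k\cdot \left(\lfloor\ln(\hat c\,d^k)\rfloor +1\right)^k\right\rfloor,$$ such that $$d_{BM}(F_d, i_{d,s}(F_d))\le \left(e s^k\right)^{\frac 1s},\quad d\in\mathbb N.$$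
   Context: $\mathbb N=\{1,2,\dots\}$, $\mathbb Z_+=\{0,1,2,\dots\}$. $C(K)$ is the Banach space of real continuous functions on a (nonempty) compact Hausdorff space $K$ with the supremum norm. A filtered subalgebra $F\subset C(K)$ is a subalgebra with linear subspaces $F_0\subseteq F_1\subseteq\cdots\subseteq F$ such that $F=\bigcup_{d\in\mathbb Z_+}F_d$ and $F_i\cdot F_j\subset F_{i+j}$ for all $i,j\in\mathbb Z_+$. Each $F_d$ carries the supremum norm of $C(K)$. $\ell^\infty_N$ is $\mathbb R^N$ with the maximum norm, and $i_{d,s}(F_d)$ carries the norm induced from $\ell^\infty_{N_{d,s}}$. The Banach-Mazur distance between two finite-dimensional real Banach spaces $E,G$ of the same dimension is $d_{BM}(E,G):=\inf\{\|u\|\cdot\|u^{-1}\|\}$, the infimum taken over all linear isomorphisms $u:E\to G$. $\lfloor\cdot\rfloor$ is the floor function. *)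

theory Defs
  imports "HOL-Analysis.Analysis"
begin

text \<open>
  A compact Hausdorff space \<open>K\<close> is a type \<open>'a :: t2_space\<close> together with the assumption
  \<open>compact (UNIV :: 'a set)\<close>. Every continuous function on such a space is bounded, so
  \<open>'a \<Rightarrow>\<^sub>C real\<close> with its library norm is exactly \<open>C(K)\<close> with the supremum norm.
\<close>

context
  includes bcontfun.lifting
begin

lift_definition mult_bcontfun ::
    "('a::topological_space \<Rightarrow>\<^sub>C real) \<Rightarrow> ('a \<Rightarrow>\<^sub>C real) \<Rightarrow> ('a \<Rightarrow>\<^sub>C real)"
  is "\<lambda>f g x. f x * g x"
proof -
  fix f g :: "'a \<Rightarrow> real"
  assume f: "f \<in> bcontfun" and g: "g \<in> bcontfun"
  obtain a where a: "\<And>x. norm (f x) \<le> a"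
    using f by (auto simp: bcontfun_def bounded_iff)
  obtain b where b: "\<And>x. norm (g x) \<le> b"
    using g by (auto simp: bcontfun_def bounded_iff)
  show "(\<lambda>x. f x * g x) \<in> bcontfun"
  proof (rule bcontfun_normI)
    show "continuous_on UNIV (\<lambda>x. f x * g x)"
      using f g by (auto simp: bcontfun_def intro!: continuous_intros)
    show "norm (f x * g x) \<le> a * b" for x
      unfolding norm_mult
      by (intro mult_mono a b norm_ge_zero order_trans[OF norm_ge_zero a])
  qed
qed

end

lemma apply_mult_bcontfun [simp]:
  "apply_bcontfun (mult_bcontfun f g) x = apply_bcontfun f x * apply_bcontfun g x"
  by (simp add: mult_bcontfun.rep_eq)

definition subalgebra :: "('a::topological_space \<Rightarrow>\<^sub>C real) set \<Rightarrow> bool" where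
  "subalgebra F \<longleftrightarrow> subspace F \<and> (\<forall>f\<in>F. \<forall>g\<in>F. mult_bcontfun f g \<in> F)"

definition filtered_subalgebra ::
    "('a::topological_space \<Rightarrow>\<^sub>C real) set \<Rightarrow> (nat \<Rightarrow> ('a \<Rightarrow>\<^sub>C real) set) \<Rightarrow> bool" where
  "filtered_subalgebra F Fd \<longleftrightarrow>
     subalgebra F \<and>
     (\<forall>d. subspace (Fd d)) \<and>
     (\<forall>d. Fd d \<subseteq> Fd (Suc d)) \<and>
     F = (\<Union>d. Fd d) \<and>
     (\<forall>i j. \<forall>f\<in>Fd i. \<forall>g\<in>Fd j. mult_bcontfun f g \<in> Fd (i + j))"

text \<open>
  The library's \<^const>\<open>dim\<close> is \<open>0\<close> on infinite-dimensional spaces, so finiteness of the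
  dimension has to be stated separately.
\<close>

definition finite_dim :: "'a::real_vector set \<Rightarrow> bool" where
  "finite_dim V \<longleftrightarrow> (\<exists>B. finite B \<and> V \<subseteq> span B)"

text \<open>
  The dimension \<open>N\<close> of \<open>\<ell>\<^sup>\<infinity>\<^sub>N\<close> varies inside the statement, so it cannot be a type. As \<open>nat\<close> carries
  the discrete topology, \<open>nat \<Rightarrow>\<^sub>C real\<close> is the space of all bounded sequences with the supremum
  norm, and \<open>\<real>\<^sup>N\<close> is embedded by padding with zeros; the induced norm is the maximum norm.
\<close>

definition linf :: "nat \<Rightarrow> (nat \<Rightarrow>\<^sub>C real) set" where
  "linf N = {x. \<forall>i\<ge>N. apply_bcontfun x i = 0}"

lemma norm_linf:
  assumes "x \<in> linf N" "N > 0"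
  shows "norm x = Max ((\<lambda>i. \<bar>apply_bcontfun x i\<bar>) ` {..<N})" (is "_ = ?M")
proof (rule antisym)
  have le: "\<bar>apply_bcontfun x i\<bar> \<le> ?M" if "i < N" for i
    using that by (intro Max_ge) auto
  have "0 \<le> ?M"
    using le[OF assms(2)] by (rule order_trans[OF abs_ge_zero])
  then have "norm (apply_bcontfun x i) \<le> ?M" for i
    using le[of i] assms(1) by (cases "i < N") (simp_all add: linf_def)
  then show "norm x \<le> ?M"
    by (rule norm_bound)
  show "?M \<le> norm x"
    using assms(2) norm_bounded[of x] by (subst Max_le_iff) auto
qed

definition linear_map_on :: "'a::real_vector set \<Rightarrow> ('a \<Rightarrow> 'b::real_vector) \<Rightarrow> bool" where
  "linear_map_on E u \<longleftrightarrow>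
     (\<forall>x\<in>E. \<forall>y\<in>E. u (x + y) = u x + u y) \<and> (\<forall>c. \<forall>x\<in>E. u (c *\<^sub>R x) = c *\<^sub>R u x)"

definition linear_iso_on ::
    "'a::real_vector set \<Rightarrow> 'b::real_vector set \<Rightarrow> ('a \<Rightarrow> 'b) \<Rightarrow> bool" where
  "linear_iso_on E G u \<longleftrightarrow> linear_map_on E u \<and> bij_betw u E G"

text \<open>
  As in the library's \<^const>\<open>onorm\<close>, the point \<open>0 \<in> E\<close> contributes the value \<open>0 / 0 = 0\<close>.
\<close>

definition onorm_on ::
    "'a::real_normed_vector set \<Rightarrow> ('a \<Rightarrow> 'b::real_normed_vector) \<Rightarrow> real" where
  "onorm_on E u = (SUP x\<in>E. norm (u x) / norm x)"

text \<open>
  For subspaces \<open>E\<close> and \<open>G\<close> of the same finite dimension the suprema in \<^const>\<open>onorm_on\<close> are finite and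
  the infimum below is over a nonempty set of nonnegative reals; in other cases the value is
  meaningless.
\<close>

definition banach_mazur_dist ::
    "'a::real_normed_vector set \<Rightarrow> 'b::real_normed_vector set \<Rightarrow> real" where
  "banach_mazur_dist E G =
     Inf {onorm_on E u * onorm_on G (inv_into E u) | u. linear_iso_on E G u}"

text \<open>
  The natural logarithm is only ever applied to \<open>c d\<^sup>k \<ge> dim F\<^sub>d \<ge> 1\<close>, so all bases of real powers
  are positive and the argument of \<^const>\<open>nat\<close> is nonnegative.
\<close>

definition embedding_dim :: "real \<Rightarrow> real \<Rightarrow> nat \<Rightarrow> nat \<Rightarrow> nat" where
  "embedding_dim c k d s =
     nat \<lfloor>c * real d powr k * real s powr k *
          (real_of_int \<lfloor>ln (c * real d powr k)\<rfloor> + 1) powr k\<rfloor>"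

end

theory Submission
  imports Defs "Jordan_Normal_Form.Determinant"
begin

text \<open>
  Put \<open>M = \<lfloor>ln (c d\<^sup>k)\<rfloor> + 1\<close> and \<open>m = s M\<close>. The \<open>m\<close>-th power of a function in \<open>F\<^sub>d\<close> lies in
  \<open>F\<^sub>d\<^sub>m\<close>, whose dimension \<open>n\<close> is at most \<open>c d\<^sup>k s\<^sup>k M\<^sup>k\<close>, hence at most the integer part of that
  number. A finite-dimensional space \<open>E\<close> of continuous functions on a compact space has Fekete
  points: there are \<open>x\<^sub>1, \<dots>, x\<^sub>n\<close> with \<open>n = dim E\<close> and a basis \<open>l\<^sub>1, \<dots>, l\<^sub>n\<close> of \<open>E\<close> dual to the
  evaluations at these points and satisfying \<open>\<bar>l\<^sub>i\<bar> \<le> 1\<close> (lemma \<open>fekete_system\<close>), so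
  \<open>\<parallel>g\<parallel> \<le> n max \<bar>g(x\<^sub>i)\<bar>\<close> for \<open>g \<in> E\<close>.

  Taking \<open>E = F\<^sub>d\<^sub>m\<close> and \<open>g = f\<^sup>m\<close> gives \<open>\<parallel>f\<parallel> \<le> n\<^bsup>1/m\<^esup> max \<bar>f(x\<^sub>i)\<bar>\<close> for \<open>f \<in> F\<^sub>d\<close>
  (lemma \<open>norm_le_sample\<close>). Therefore sampling at these points is an injective contraction of \<open>F\<^sub>d\<close>
  into \<open>\<ell>\<^sup>\<infinity>\<^sub>n\<close> whose inverse has norm at most \<open>n\<^bsup>1/m\<^esup>\<close>. This number is at most
  \<open>(c d\<^sup>k)\<^bsup>1/m\<^esup> (s M)\<^bsup>k/(s M)\<^esup>\<close>; the first factor is at most \<open>e\<^bsup>1/s\<^esup>\<close> because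
  \<open>ln (c d\<^sup>k) \<le> M\<close>, and the second one is at most \<open>s\<^bsup>k/s\<^esup>\<close> because \<open>t\<^bsup>1/t\<^esup>\<close> decreases for
  \<open>t \<ge> e\<close> (lemma \<open>dimension_root_bound\<close>).
\<close>

section \<open>Lagrange bases of finite-dimensional function spaces\<close>

lemma apply_sum_bcontfun:
  fixes f :: "'i \<Rightarrow> 'a::topological_space \<Rightarrow>\<^sub>C real"
  shows "apply_bcontfun (\<Sum>i\<in>I. f i) t = (\<Sum>i\<in>I. apply_bcontfun (f i) t)"
  by (induction I rule: infinite_finite_induct) simp_all

text \<open>
  Points \<open>x\<^sub>0, \<dots>, x\<^sub>n\<^sub>-\<^sub>1\<close> and functions \<open>l\<^sub>0, \<dots>, l\<^sub>n\<^sub>-\<^sub>1\<close> in \<open>E\<close> with \<open>l\<^sub>i(x\<^sub>j) = \<delta>\<^sub>i\<^sub>j\<close> such that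
  Lagrange interpolation at the points reproduces every function in \<open>E\<close>. The values of \<open>x\<close> and \<open>l\<close>
  at indices \<open>\<ge> n\<close> are irrelevant.
\<close>

definition lagrange_system ::
    "('a::topological_space \<Rightarrow>\<^sub>C real) set \<Rightarrow> nat \<Rightarrow> (nat \<Rightarrow> 'a) \<Rightarrow> (nat \<Rightarrow> 'a \<Rightarrow>\<^sub>C real) \<Rightarrow> bool" where
  "lagrange_system E n x l \<longleftrightarrow>
     (\<forall>i<n. l i \<in> E) \<and>
     (\<forall>i<n. \<forall>j<n. apply_bcontfun (l i) (x j) = of_bool (i = j)) \<and>
     (\<forall>f\<in>E. (\<Sum>i<n. apply_bcontfun f (x i) *\<^sub>R l i) = f)"

lemma lagrange_systemD:
  assumes "lagrange_system E n x l"
  shows "i < n \<Longrightarrow> l i \<in> E"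
    and "i < n \<Longrightarrow> j < n \<Longrightarrow> apply_bcontfun (l i) (x j) = of_bool (i = j)"
    and "f \<in> E \<Longrightarrow> (\<Sum>i<n. apply_bcontfun f (x i) *\<^sub>R l i) = f"
  using assms unfolding lagrange_system_def by blast+

lemma delta_independent:
  fixes l :: "nat \<Rightarrow> 'a::topological_space \<Rightarrow>\<^sub>C real"
  assumes delta: "\<And>i j. i < n \<Longrightarrow> j < n \<Longrightarrow> apply_bcontfun (l i) (x j) = of_bool (i = j)"
  shows "inj_on l {..<n}" and "independent (l ` {..<n})"
proof -
  show inj: "inj_on l {..<n}"
  proof (rule inj_onI)
    fix i j assume ij: "i \<in> {..<n}" "j \<in> {..<n}" and eq: "l i = l j"
    have "apply_bcontfun (l i) (x i) = 1" "apply_bcontfun (l j) (x i) = of_bool (j = i)"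
      using ij by (auto simp: delta)
    then show "i = j"
      unfolding eq by (simp split: if_splits)
  qed
  show "independent (l ` {..<n})"
  proof (rule independent_if_scalars_zero)
    fix a v
    assume 0: "(\<Sum>v\<in>l ` {..<n}. a v *\<^sub>R v) = 0" and "v \<in> l ` {..<n}"
    then obtain j where j: "j < n" "v = l j" by auto
    have "0 = apply_bcontfun (\<Sum>i<n. a (l i) *\<^sub>R l i) (x j)"
      using 0 by (simp add: sum.reindex[OF inj])
    also have "\<dots> = (\<Sum>i<n. if i = j then a (l i) else 0)"
      unfolding apply_sum_bcontfun using j by (intro sum.cong) (auto simp: delta)
    also have "\<dots> = a v" using j by simp
    finally show "a v = 0" by simp
  qed simp
qed

lemma lagrange_system_spans:
  assumes "lagrange_system E n x l"
  shows "E \<subseteq> span (l ` {..<n})"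
proof
  fix f assume "f \<in> E"
  then have "(\<Sum>i<n. apply_bcontfun f (x i) *\<^sub>R l i) = f"
    by (rule lagrange_systemD[OF assms])
  moreover have "(\<Sum>i<n. apply_bcontfun f (x i) *\<^sub>R l i) \<in> span (l ` {..<n})"
    by (intro span_sum span_scale span_base) auto
  ultimately show "f \<in> span (l ` {..<n})" by simp
qed

lemma dim_lagrange_system:
  assumes "lagrange_system E n x l"
  shows "dim E = n"
proof (rule dim_unique[OF _ lagrange_system_spans[OF assms]])
  show "l ` {..<n} \<subseteq> E"
    using lagrange_systemD(1)[OF assms] by auto
  note ind = delta_independent[where l = l and x = x and n = n, OF lagrange_systemD(2)[OF assms]]
  show "independent (l ` {..<n})" by (rule ind)
  show "card (l ` {..<n}) = n" using ind(1) by (simp add: card_image)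
qed

text \<open>
  Biorthogonality alone suffices when \<open>E\<close> lies in the span of at most \<open>n\<close> vectors: the
  functions \<open>l\<^sub>i\<close> are independent, so they span \<open>E\<close>.
\<close>

lemma lagrange_systemI:
  assumes E: "E \<subseteq> span B" "finite B" "card B \<le> n"
    and l: "\<And>i. i < n \<Longrightarrow> l i \<in> E"
    and delta: "\<And>i j. i < n \<Longrightarrow> j < n \<Longrightarrow> apply_bcontfun (l i) (x j) = of_bool (i = j)"
  shows "lagrange_system E n x l"
  unfolding lagrange_system_def
proof (intro conjI allI impI ballI)
  fix f assume f: "f \<in> E"
  note ind = delta_independent[where l = l and x = x and n = n, OF delta]
  have "f \<in> span (l ` {..<n})"
  proof (rule ccontr)
    assume nin: "f \<notin> span (l ` {..<n})"
    then have "independent (insert f (l ` {..<n}))"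
      by (rule independent_insertI) (rule ind)
    moreover have "insert f (l ` {..<n}) \<subseteq> span B"
      using f l E by auto
    ultimately have "card (insert f (l ` {..<n})) \<le> card B"
      using independent_span_bound[OF E(2)] by blast
    moreover have "f \<notin> l ` {..<n}"
      using nin by (metis span_base)
    ultimately show False
      using ind(1) E(3) by (simp add: card_image)
  qed
  moreover have "span (l ` {..<n}) \<subseteq> {f. (\<Sum>i<n. apply_bcontfun f (x i) *\<^sub>R l i) = f}"
  proof (rule span_minimal)
    show "subspace {f. (\<Sum>i<n. apply_bcontfun f (x i) *\<^sub>R l i) = f}"
      unfolding subspace_def
    proof (safe, goal_cases)
      case 1
      then show ?case by simp
    next
      case (2 f g)
      then show ?case by (simp add: scaleR_left_distrib sum.distrib)
    next
      case (3 a f)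
      then have "a *\<^sub>R (\<Sum>i<n. apply_bcontfun f (x i) *\<^sub>R l i) = a *\<^sub>R f" by simp
      then show ?case by (simp add: scaleR_sum_right)
    qed
    show "l ` {..<n} \<subseteq> {f. (\<Sum>i<n. apply_bcontfun f (x i) *\<^sub>R l i) = f}"
    proof clarsimp
      fix j assume "j < n"
      have "(\<Sum>i<n. apply_bcontfun (l j) (x i) *\<^sub>R l i) = (\<Sum>i<n. if i = j then l i else 0)"
        using \<open>j < n\<close> by (intro sum.cong) (auto simp: delta)
      then show "(\<Sum>i<n. apply_bcontfun (l j) (x i) *\<^sub>R l i) = l j"
        using \<open>j < n\<close> by simp
    qed
  qed
  ultimately show "(\<Sum>i<n. apply_bcontfun f (x i) *\<^sub>R l i) = f" by blast
qed (rule l delta, assumption+)+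

lemma lagrange_system_span:
  fixes B :: "('a::topological_space \<Rightarrow>\<^sub>C real) set"
  assumes "finite B"
  shows "\<exists>n x l. lagrange_system (span B) n x l"
  using assms
proof (induction B)
  case empty
  have "lagrange_system (span {}) 0 x l" for x :: "nat \<Rightarrow> 'a" and l
    by (auto simp: lagrange_system_def)
  then show ?case by blast
next
  case (insert b B)
  then obtain n x l where sys: "lagrange_system (span B) n x l" by blast
  note l = lagrange_systemD(1)[OF sys] and delta = lagrange_systemD(2)[OF sys]
  define b' where "b' = (\<Sum>i<n. apply_bcontfun b (x i) *\<^sub>R l i)"
  have b': "b' \<in> span B"
    unfolding b'_def by (intro span_sum span_scale l) auto
  \<comment> \<open>the interpolation error of \<open>b\<close>; a point where it does not vanish becomes the new node\<close>
  define g where "g = b - b'"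
  show ?case
  proof (cases "g = 0")
    case True
    then have "b \<in> span B" using b' by (simp add: g_def)
    then show ?thesis using sys by (metis span_redundant)
  next
    case False
    then obtain t where t: "apply_bcontfun g t \<noteq> 0"
      by (metis bcontfun_eqI zero_bcontfun.rep_eq)
    have g0: "apply_bcontfun g (x j) = 0" if "j < n" for j
    proof -
      have "(\<Sum>i<n. apply_bcontfun b (x i) * apply_bcontfun (l i) (x j)) =
          (\<Sum>i<n. if i = j then apply_bcontfun b (x i) else 0)"
        using that by (intro sum.cong) (auto simp: delta)
      then show ?thesis using that by (simp add: g_def b'_def apply_sum_bcontfun)
    qed
    have mono: "span B \<subseteq> span (insert b B)" by (intro span_mono) auto
    define p where "p = (1 / apply_bcontfun g t) *\<^sub>R g"
    have p: "p \<in> span (insert b B)"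
      using b' mono unfolding p_def g_def by (intro span_scale span_diff) (auto intro: span_base)
    have p_apply: "apply_bcontfun p t = 1" "\<And>j. j < n \<Longrightarrow> apply_bcontfun p (x j) = 0"
      using t g0 by (auto simp: p_def)
    \<comment> \<open>the old basis is corrected by multiples of \<open>p\<close> so as to vanish at the new node\<close>
    let ?x = "x(n := t)"
    let ?l = "\<lambda>i. if i < n then l i - apply_bcontfun (l i) t *\<^sub>R p else p"
    have spanB: "span B \<subseteq> span (l ` {..<n})"
      by (rule lagrange_system_spans[OF sys])
    have sub: "span (insert b B) \<subseteq> span (insert b (l ` {..<n}))"
      unfolding span_insert[of b B] span_insert[of b "l ` {..<n}"]
      using spanB by blast
    have "lagrange_system (span (insert b B)) (Suc n) ?x ?l"
    proof (rule lagrange_systemI[OF sub])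
      show "card (insert b (l ` {..<n})) \<le> Suc n"
        using card_image_le[of "{..<n}" l] by (simp add: card_insert_if)
      show "?l i \<in> span (insert b B)" for i
        using p l[of i] mono by (auto intro!: span_diff span_scale)
      show "apply_bcontfun (?l i) (?x j) = of_bool (i = j)" if "i < Suc n" "j < Suc n" for i j
        using that p_apply delta[of i j] by (auto simp: less_Suc_eq)
    qed simp
    then show ?thesis by blast
  qed
qed

lemma lagrange_system_exists:
  fixes E :: "('a::topological_space \<Rightarrow>\<^sub>C real) set"
  assumes "subspace E" "finite_dim E"
  obtains x l where "lagrange_system E (dim E) x l"
proof -
  obtain B0 where B0: "finite B0" "E \<subseteq> span B0"
    using assms(2) by (auto simp: finite_dim_def)
  obtain B where B: "B \<subseteq> E" "independent B" "E \<subseteq> span B"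
    using basis_exists by metis
  have "finite B"
    using independent_span_bound[OF B0(1) B(2)] B(1) B0(2) by blast
  moreover have "span B = E"
    using B(1,3) span_minimal[OF B(1) assms(1)] by auto
  ultimately obtain n x l where "lagrange_system E n x l"
    using lagrange_system_span by metis
  then show thesis
    using that dim_lagrange_system by metis
qed

section \<open>Fekete points\<close>

text \<open>
  The matrix of values of \<open>l\<^sub>0, \<dots>, l\<^sub>n\<^sub>-\<^sub>1\<close> at the points \<open>y\<^sub>0, \<dots>, y\<^sub>n\<^sub>-\<^sub>1\<close>; its determinant
  generalizes the Vandermonde determinant.
\<close>

definition value_mat ::
    "nat \<Rightarrow> (nat \<Rightarrow> 'a::topological_space \<Rightarrow>\<^sub>C real) \<Rightarrow> (nat \<Rightarrow> 'a) \<Rightarrow> real mat" where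
  "value_mat n l y = mat n n (\<lambda>(i, j). apply_bcontfun (l i) (y j))"

lemma value_mat_carrier [simp]: "value_mat n l y \<in> carrier_mat n n"
  by (simp add: value_mat_def)

lemma compact_UNIV_fun:
  assumes "compact (UNIV :: 'a::topological_space set)"
  shows "compact (UNIV :: (nat \<Rightarrow> 'a) set)"
proof -
  have "compact_space (product_topology (\<lambda>_::nat. euclidean :: 'a topology) UNIV)"
    using assms unfolding compact_space_product_topology
    by (simp add: compact_space_def)
  then show ?thesis
    by (simp add: euclidean_product_topology compact_space_def)
qed

lemma continuous_on_det_value_mat:
  "continuous_on UNIV (\<lambda>y. det (value_mat n l y))"
proof -
  have "det (value_mat n l y) = (\<Sum>p | p permutes {0..<n}. signof p *
      (\<Prod>i = 0..<n. apply_bcontfun (l i) (y (p i))))" for y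
  proof -
    have "(\<Prod>i = 0..<n. value_mat n l y $$ (i, p i)) =
        (\<Prod>i = 0..<n. apply_bcontfun (l i) (y (p i)))" if "p permutes {0..<n}" for p
      using permutes_in_image[OF that] by (intro prod.cong) (auto simp: value_mat_def)
    then show ?thesis
      by (simp add: det_def'[OF value_mat_carrier])
  qed
  moreover have "continuous_on UNIV (\<lambda>y. apply_bcontfun f (y j))" for f :: "'a \<Rightarrow>\<^sub>C real" and j :: nat
    by (rule continuous_on_compose2[OF continuous_on_apply_bcontfun[of UNIV]])
      (auto intro: continuous_on_product_coordinates)
  ultimately show ?thesis
    by (auto intro!: continuous_intros)
qed

text \<open>
  At a maximum of the absolute value of the determinant, replacing one point by an arbitrary \<open>t\<close>
  and dividing by the maximal determinant gives a function of \<open>t\<close> bounded by \<open>1\<close>. Expanding along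
  the column of \<open>t\<close> shows that this function lies in \<open>E\<close>; at the other points two columns agree.
\<close>

lemma fekete_system:
  fixes E :: "('a::topological_space \<Rightarrow>\<^sub>C real) set"
  assumes compact: "compact (UNIV :: 'a set)" and E: "subspace E" "finite_dim E"
  obtains x l where "lagrange_system E (dim E) x l"
    and "\<And>i t. i < dim E \<Longrightarrow> \<bar>apply_bcontfun (l i) t\<bar> \<le> 1"
proof -
  define n where "n = dim E"
  obtain z l where sys: "lagrange_system E n z l"
    using lagrange_system_exists[OF E] unfolding n_def .
  note l = lagrange_systemD(1)[OF sys]
  define D where "D y = det (value_mat n l y)" for y
  have "value_mat n l z = 1\<^sub>m n"
    using lagrange_systemD(2)[OF sys] by (intro eq_matI) (auto simp: value_mat_def)
  then have Dz: "D z = 1" by (simp add: D_def)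
  have "continuous_on UNIV (\<lambda>y. \<bar>D y\<bar>)"
    unfolding D_def by (intro continuous_on_rabs continuous_on_det_value_mat)
  then obtain y where max: "\<And>v. \<bar>D v\<bar> \<le> \<bar>D y\<bar>"
    using continuous_attains_sup[OF compact_UNIV_fun[OF compact]] by (metis UNIV_I UNIV_not_empty)
  have Dy: "D y \<noteq> 0" using max[of z] Dz by auto
  define cof where "cof i j = cofactor (value_mat n l y) i j" for i j
  define L where "L j = (1 / D y) *\<^sub>R (\<Sum>i<n. cof i j *\<^sub>R l i)" for j
  have apply_L: "apply_bcontfun (L j) t = D (y(j := t)) / D y" if j: "j < n" for j t
  proof -
    have "mat_delete (value_mat n l (y(j := t))) i j = mat_delete (value_mat n l y) i j" if "i < n" for i
      using that j by (intro eq_matI) (auto simp: mat_delete_def value_mat_def)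
    then have "cofactor (value_mat n l (y(j := t))) i j = cof i j" if "i < n" for i
      using that by (simp add: cofactor_def cof_def)
    then have "D (y(j := t)) = (\<Sum>i<n. apply_bcontfun (l i) t * cof i j)"
      unfolding D_def laplace_expansion_column[OF value_mat_carrier j]
      using j by (intro sum.cong) (auto simp: value_mat_def)
    then show ?thesis
      by (simp add: L_def apply_sum_bcontfun mult.commute)
  qed
  have "lagrange_system E n y L"
  proof (rule lagrange_systemI)
    show "E \<subseteq> span (l ` {..<n})" by (rule lagrange_system_spans[OF sys])
    show "card (l ` {..<n}) \<le> n" using card_image_le[of "{..<n}" l] by simp
    show "L i \<in> E" for i
      unfolding L_def by (intro subspace_scale subspace_sum E(1) l) auto
    show "apply_bcontfun (L i) (y j) = of_bool (i = j)" if ij: "i < n" "j < n" for i j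
    proof (cases "i = j")
      case True
      then show ?thesis using Dy ij by (simp add: apply_L)
    next
      case False
      have "col (value_mat n l (y(i := y j))) i = col (value_mat n l (y(i := y j))) j"
        using ij False by (intro eq_vecI) (auto simp: value_mat_def)
      then have "D (y(i := y j)) = 0"
        unfolding D_def by (rule det_identical_columns[OF value_mat_carrier False ij])
      then show ?thesis using False ij by (simp add: apply_L)
    qed
  qed simp
  moreover have "\<bar>apply_bcontfun (L i) t\<bar> \<le> 1" if "i < n" for i t
    using max[of "y(i := t)"] Dy that by (simp add: apply_L)
  ultimately show thesis
    using that unfolding n_def by blast
qed

section \<open>The Banach-Mazur distance\<close>

lemma linear_map_on_lagrange:
  assumes sys: "lagrange_system E n x l" and E: "subspace E"
    and u: "linear_map_on E u" and f: "f \<in> E"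
  shows "u f = (\<Sum>i<n. apply_bcontfun f (x i) *\<^sub>R u (l i))"
proof -
  note l = lagrange_systemD(1)[OF sys]
  have zero: "u 0 = 0"
    using u subspace_0[OF E] unfolding linear_map_on_def by (metis scaleR_zero_left)
  have "u (\<Sum>i<m. a i *\<^sub>R l i) = (\<Sum>i<m. a i *\<^sub>R u (l i))" if "m \<le> n" for m a
    using that
  proof (induction m)
    case 0
    then show ?case by (simp add: zero)
  next
    case (Suc m)
    have "(\<Sum>i<m. a i *\<^sub>R l i) \<in> E"
      using Suc.prems by (intro subspace_sum subspace_scale E l) auto
    moreover have "a m *\<^sub>R l m \<in> E"
      using Suc.prems by (intro subspace_scale E l) auto
    ultimately show ?case
      using Suc u l[of m] by (simp add: linear_map_on_def)
  qed
  from this[of n "\<lambda>i. apply_bcontfun f (x i)"] show ?thesis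
    by (simp add: lagrange_systemD(3)[OF sys f])
qed

text \<open>
  The point of this lemma is that the supremum is over a bounded set: linear maps on a
  finite-dimensional space are bounded, here with a bound read off from a Lagrange basis. It is
  needed for every isomorphism, in order that the infimum in the Banach-Mazur distance be taken
  over a set bounded below.
\<close>

lemma onorm_on_nonneg:
  fixes E :: "('a::topological_space \<Rightarrow>\<^sub>C real) set"
  assumes E: "subspace E" "finite_dim E" and u: "linear_map_on E u"
  shows "0 \<le> onorm_on E u"
proof -
  obtain x l where sys: "lagrange_system E (dim E) x l"
    using lagrange_system_exists[OF E] .
  define C where "C = (\<Sum>i<dim E. norm (u (l i)))"
  have "norm (u f) \<le> C * norm f" if "f \<in> E" for f
  proof -
    have "norm (u f) \<le> (\<Sum>i<dim E. norm (apply_bcontfun f (x i) *\<^sub>R u (l i)))"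
      unfolding linear_map_on_lagrange[OF sys E(1) u that] by (rule norm_sum)
    also have "\<dots> \<le> (\<Sum>i<dim E. norm f * norm (u (l i)))"
      using norm_bounded[of f] by (intro sum_mono) (simp add: mult_right_mono)
    finally show ?thesis by (simp add: C_def sum_distrib_left mult.commute)
  qed
  moreover have "0 \<le> C" by (simp add: C_def sum_nonneg)
  ultimately have "bdd_above ((\<lambda>f. norm (u f) / norm f) ` E)"
    by (intro bdd_aboveI[of _ C]) (auto simp: divide_simps)
  then have "norm (u 0) / norm (0 :: 'a \<Rightarrow>\<^sub>C real) \<le> onorm_on E u"
    unfolding onorm_on_def by (rule cSUP_upper[OF subspace_0[OF E(1)]])
  then show ?thesis by simp
qed

lemma onorm_on_le:
  assumes "subspace E" "\<And>f. f \<in> E \<Longrightarrow> norm (u f) \<le> C * norm f" "0 \<le> C"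
  shows "onorm_on E u \<le> C"
  unfolding onorm_on_def
proof (rule cSUP_least)
  show "E \<noteq> {}" using subspace_0[OF assms(1)] by auto
  show "norm (u f) / norm f \<le> C" if "f \<in> E" for f
    using assms(2)[OF that] assms(3) by (auto simp: divide_simps)
qed

lemma linear_map_on_inv_into:
  assumes E: "subspace E" and u: "linear_iso_on E G u"
  shows "linear_map_on G (inv_into E u)"
proof -
  have lin: "linear_map_on E u" and inj: "inj_on u E" and G: "G = u ` E"
    using u by (auto simp: linear_iso_on_def bij_betw_def)
  have "inv_into E u (u x + u y) = x + y" if "x \<in> E" "y \<in> E" for x y
    using lin that inv_into_f_f[OF inj subspace_add[OF E that]] by (simp add: linear_map_on_def)
  moreover have "inv_into E u (a *\<^sub>R u x) = a *\<^sub>R x" if "x \<in> E" for x a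
    using lin that inv_into_f_f[OF inj subspace_scale[OF E that]] by (simp add: linear_map_on_def)
  ultimately show ?thesis
    using inj by (auto simp: linear_map_on_def G)
qed

lemma linear_map_on_image:
  fixes E :: "('a::topological_space \<Rightarrow>\<^sub>C real) set"
  assumes E: "subspace E" "finite_dim E" and u: "linear_map_on E u"
  shows "subspace (u ` E)" and "finite_dim (u ` E)"
proof -
  have add: "u x + u y = u (x + y)" if "x \<in> E" "y \<in> E" for x y
    using u that by (simp add: linear_map_on_def)
  have scale: "a *\<^sub>R u x = u (a *\<^sub>R x)" if "x \<in> E" for x a
    using u that by (simp add: linear_map_on_def)
  have "u 0 = 0"
    using scale[OF subspace_0[OF E(1)], of 0] by simp
  then show "subspace (u ` E)"
    unfolding subspace_def using E(1)
    by (auto simp: add scale subspace_add subspace_scale intro: image_eqI[OF _ subspace_0])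
  obtain x l where sys: "lagrange_system E (dim E) x l"
    using lagrange_system_exists[OF E] .
  have "u f \<in> span ((\<lambda>i. u (l i)) ` {..<dim E})" if "f \<in> E" for f
    unfolding linear_map_on_lagrange[OF sys E(1) u that]
    by (intro span_sum span_scale span_base) auto
  then show "finite_dim (u ` E)"
    unfolding finite_dim_def by (intro exI[of _ "(\<lambda>i. u (l i)) ` {..<dim E}"]) auto
qed

lemma banach_mazur_dist_le:
  fixes E :: "('a::topological_space \<Rightarrow>\<^sub>C real) set"
    and u :: "('a \<Rightarrow>\<^sub>C real) \<Rightarrow> ('b::topological_space \<Rightarrow>\<^sub>C real)"
  assumes E: "subspace E" "finite_dim E" and u: "linear_map_on E u" "inj_on u E"
    and upper: "\<And>f. f \<in> E \<Longrightarrow> norm (u f) \<le> norm f"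
    and lower: "\<And>f. f \<in> E \<Longrightarrow> norm f \<le> C * norm (u f)" and "0 \<le> C"
  shows "banach_mazur_dist E (u ` E) \<le> C"
proof -
  let ?G = "u ` E"
  let ?S = "{onorm_on E v * onorm_on ?G (inv_into E v) | v. linear_iso_on E ?G v}"
  note G = linear_map_on_image[OF E u(1)]
  have iso: "linear_iso_on E ?G u"
    using u by (auto simp: linear_iso_on_def bij_betw_def)
  have nonneg: "0 \<le> onorm_on E v" "0 \<le> onorm_on ?G (inv_into E v)" if "linear_iso_on E ?G v" for v
    using that onorm_on_nonneg[OF E] onorm_on_nonneg[OF G]
      linear_map_on_inv_into[OF E(1) that] by (auto simp: linear_iso_on_def)
  have "bdd_below ?S"
    using nonneg by (intro bdd_belowI[of _ 0]) auto
  then have "banach_mazur_dist E ?G \<le> onorm_on E u * onorm_on ?G (inv_into E u)"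
    unfolding banach_mazur_dist_def using iso by (intro cInf_lower) auto
  also have "\<dots> \<le> 1 * C"
  proof (intro mult_mono nonneg(2)[OF iso])
    show "onorm_on E u \<le> 1"
      using upper by (intro onorm_on_le[OF E(1)]) auto
    show "onorm_on ?G (inv_into E u) \<le> C"
      using lower u(2) \<open>0 \<le> C\<close> by (intro onorm_on_le[OF G(1)]) auto
  qed simp
  finally show ?thesis by simp
qed

section \<open>Sampling at finitely many points\<close>

text \<open>
  The values of \<open>f\<close> at \<open>x\<^sub>0, \<dots>, x\<^sub>n\<^sub>-\<^sub>1\<close>, padded with zeros to a bounded sequence.
\<close>

definition sample ::
    "nat \<Rightarrow> (nat \<Rightarrow> 'a::topological_space) \<Rightarrow> ('a \<Rightarrow>\<^sub>C real) \<Rightarrow> (nat \<Rightarrow>\<^sub>C real)" where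
  "sample n x f = Bcontfun (\<lambda>j. if j < n then apply_bcontfun f (x j) else 0)"

lemma apply_sample:
  "apply_bcontfun (sample n x f) j = (if j < n then apply_bcontfun f (x j) else 0)"
proof -
  have "(\<lambda>j. if j < n then apply_bcontfun f (x j) else 0) \<in> bcontfun"
    using norm_bounded[of f] by (intro bcontfun_normI[of _ "norm f"]) auto
  then show ?thesis by (simp add: sample_def Bcontfun_inverse)
qed

lemma linear_map_on_sample: "linear_map_on E (sample n x)"
  by (auto simp: linear_map_on_def apply_sample intro!: bcontfun_eqI)

lemma sample_in_linf: "n \<le> N \<Longrightarrow> sample n x f \<in> linf N"
  by (simp add: linf_def apply_sample)

lemma norm_sample_le: "norm (sample n x f) \<le> norm f"
  using norm_bounded[of f] by (intro norm_bound) (simp add: apply_sample)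

text \<open>
  If the \<open>m\<close>-th power of \<open>f\<close> lies in a space with a Lagrange basis bounded by \<open>1\<close>, the trivial
  bound \<open>n\<close> for the interpolation operator improves to \<open>n\<^bsup>1/m\<^esup>\<close> for \<open>f\<close> itself.
\<close>

lemma norm_le_sample:
  assumes sys: "lagrange_system E n x l"
    and l: "\<And>i t. i < n \<Longrightarrow> \<bar>apply_bcontfun (l i) t\<bar> \<le> 1"
    and g: "g \<in> E" "\<And>t. apply_bcontfun g t = apply_bcontfun f t ^ m"
    and m: "m > 0"
  shows "norm f \<le> root m (real n) * norm (sample n x f)"
proof (rule norm_bound)
  fix t
  have "apply_bcontfun g t = apply_bcontfun (\<Sum>i<n. apply_bcontfun g (x i) *\<^sub>R l i) t"
    by (simp add: lagrange_systemD(3)[OF sys g(1)])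
  also have "\<dots> = (\<Sum>i<n. apply_bcontfun g (x i) * apply_bcontfun (l i) t)"
    by (simp add: apply_sum_bcontfun)
  finally have "\<bar>apply_bcontfun f t\<bar> ^ m \<le> (\<Sum>i<n. \<bar>apply_bcontfun f (x i) ^ m * apply_bcontfun (l i) t\<bar>)"
    by (simp add: g(2) flip: power_abs)
  also have "\<dots> \<le> (\<Sum>i<n. norm (sample n x f) ^ m)"
  proof (intro sum_mono)
    fix i assume i: "i \<in> {..<n}"
    then have "\<bar>apply_bcontfun f (x i)\<bar> \<le> norm (sample n x f)"
      using norm_bounded[of "sample n x f" i] by (simp add: apply_sample)
    then have "\<bar>apply_bcontfun f (x i)\<bar> ^ m * \<bar>apply_bcontfun (l i) t\<bar> \<le> norm (sample n x f) ^ m * 1"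
      using l i by (intro mult_mono power_mono) auto
    then show "\<bar>apply_bcontfun f (x i) ^ m * apply_bcontfun (l i) t\<bar> \<le> norm (sample n x f) ^ m"
      by (simp add: abs_mult power_abs)
  qed
  also have "\<dots> = (root m (real n) * norm (sample n x f)) ^ m"
    using m by (simp add: power_mult_distrib)
  finally show "norm (apply_bcontfun f t) \<le> root m (real n) * norm (sample n x f)"
    using m by (simp add: power_mono_iff)
qed

lemma power_in_filtration:
  assumes filtered: "filtered_subalgebra F Fd" and const: "const_bcontfun 1 \<in> Fd 0"
    and f: "f \<in> Fd d"
  shows "\<exists>g \<in> Fd (d * m). \<forall>t. apply_bcontfun g t = apply_bcontfun f t ^ m"
proof (induction m)
  case 0
  then show ?case using const by (intro bexI[of _ "const_bcontfun 1"]) auto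
next
  case (Suc m)
  then obtain g where g: "g \<in> Fd (d * m)" "\<forall>t. apply_bcontfun g t = apply_bcontfun f t ^ m" by blast
  have "mult_bcontfun f g \<in> Fd (d + d * m)"
    using filtered f g(1) by (auto simp: filtered_subalgebra_def)
  then show ?case
    using g(2) by (intro bexI[of _ "mult_bcontfun f g"]) auto
qed

section \<open>A bound for the root of the dimension\<close>

lemma dimension_root_bound:
  fixes A k n :: real and s M :: nat
  assumes A: "A > 0" "ln A \<le> real M" and M: "M \<ge> 1" and s: "s \<ge> 3" and k: "k \<ge> 0"
    and n: "0 < n" "n \<le> A * real s powr k * real M powr k"
  shows "root (s * M) n \<le> (exp 1 * real s powr k) powr (1 / real s)"
proof -
  have "ln (real M) \<le> real M - 1"
    using M by (intro ln_le_minus_one) auto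
  \<comment> \<open>this is where \<open>s \<ge> 3\<close> enters: it makes \<open>ln s \<ge> 1\<close>\<close>
  moreover have "1 \<le> ln (real s)"
    using s exp_le by (subst ln_ge_iff) auto
  \<comment> \<open>equivalent to \<open>ln (s M) / (s M) \<le> ln s / s\<close>\<close>
  ultimately have lnM: "ln (real M) \<le> (real M - 1) * ln (real s)"
    using M mult_left_mono[of 1 "ln (real s)" "real M - 1"] by auto
  have "ln n \<le> ln (A * real s powr k * real M powr k)"
    using n by (subst ln_le_cancel_iff) auto
  also have "\<dots> = ln A + k * (ln (real s) + ln (real M))"
    using A M s by (simp add: ln_mult ln_powr algebra_simps)
  also have "\<dots> \<le> real M + k * (real M * ln (real s))"
    using A lnM k by (intro add_mono mult_left_mono) (auto simp: algebra_simps)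
  finally have "ln n / real (s * M) \<le> (1 + k * ln (real s)) / real s"
    using M s by (simp add: field_simps)
  moreover have "root (s * M) n = exp (ln n / real (s * M))"
    using n M s by (simp add: root_powr_inverse powr_def divide_inverse mult.commute)
  moreover have "(exp 1 * real s powr k) powr (1 / real s) = exp ((1 + k * ln (real s)) / real s)"
    using s by (simp add: powr_def flip: exp_add)
  ultimately show ?thesis by simp
qed

section \<open>Embedding the filtration\<close>

theorem corollary1p2:
  fixes F :: "('a::t2_space \<Rightarrow>\<^sub>C real) set"
    and Fd :: "nat \<Rightarrow> ('a \<Rightarrow>\<^sub>C real) set"
    and k c :: real
    and s :: nat
  assumes compact: "compact (UNIV :: 'a set)"
    and filtered: "filtered_subalgebra F Fd"
    and finite_dim: "\<And>d. finite_dim (Fd d)"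
    and constants: "\<And>a. const_bcontfun a \<in> Fd 0"
    and "k \<ge> 0" and "c \<ge> 0"
    and growth: "\<And>d. d \<ge> 1 \<Longrightarrow> real (dim (Fd d)) \<le> c * real d powr k"
    and "s \<ge> 3"
  shows "\<exists>i :: nat \<Rightarrow> ('a \<Rightarrow>\<^sub>C real) \<Rightarrow> (nat \<Rightarrow>\<^sub>C real). \<forall>d\<ge>1.
           linear_map_on (Fd d) (i d) \<and>
           inj_on (i d) (Fd d) \<and>
           i d ` Fd d \<subseteq> linf (embedding_dim c k d s) \<and>
           banach_mazur_dist (Fd d) (i d ` Fd d) \<le> (exp 1 * real s powr k) powr (1 / real s)"
proof -
  have "\<exists>u. linear_map_on (Fd d) u \<and> inj_on u (Fd d) \<and> u ` Fd d \<subseteq> linf (embedding_dim c k d s) \<and>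
      banach_mazur_dist (Fd d) (u ` Fd d) \<le> (exp 1 * real s powr k) powr (1 / real s)"
    if d: "d \<ge> 1" for d
  proof -
    have sub: "subspace (Fd j)" for j
      using filtered by (auto simp: filtered_subalgebra_def)
    have const: "const_bcontfun a \<in> Fd j" for a j
    proof (induction j)
      case 0
      show ?case by (rule constants)
    next
      case (Suc j)
      then show ?case using filtered by (auto simp: filtered_subalgebra_def)
    qed
    \<comment> \<open>the constants make every \<open>F\<^sub>j\<close> nontrivial, hence \<open>c d\<^sup>k \<ge> 1\<close> and \<open>ln (c d\<^sup>k) \<ge> 0\<close>\<close>
    have dim_pos: "dim (Fd j) > 0" for j
    proof (rule ccontr)
      assume "\<not> dim (Fd j) > 0"
      then obtain x l where "lagrange_system (Fd j) 0 x l"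
        using lagrange_system_exists[OF sub finite_dim, of j] by auto
      then have "const_bcontfun 1 = (0 :: 'a \<Rightarrow>\<^sub>C real)"
        using lagrange_systemD(3)[OF _ const[of 1 j]] by fastforce
      then show False
        by (metis const_bcontfun.rep_eq zero_bcontfun.rep_eq zero_neq_one)
    qed
    define A where "A = c * real d powr k"
    have "1 \<le> real (dim (Fd d))" using dim_pos[of d] by linarith
    then have A1: "A \<ge> 1" using growth[OF d] by (simp add: A_def)
    define M where "M = nat (\<lfloor>ln A\<rfloor> + 1)"
    have ln0: "0 \<le> ln A" using A1 by simp
    have M: "M \<ge> 1" "real M = real_of_int \<lfloor>ln A\<rfloor> + 1" "ln A \<le> real M"
      using ln0 by (auto simp: M_def) linarith+
    define m where "m = s * M"
    have m: "m > 0" using M(1) \<open>s \<ge> 3\<close> by (simp add: m_def)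
    define n where "n = dim (Fd (d * m))"
    have "real n \<le> c * real (d * m) powr k"
      unfolding n_def using d m by (intro growth) auto
    also have "\<dots> = A * real s powr k * real M powr k"
      by (simp add: A_def m_def powr_mult)
    finally have n: "real n \<le> A * real s powr k * real M powr k" .
    have "embedding_dim c k d s = nat \<lfloor>A * real s powr k * real M powr k\<rfloor>"
      by (simp add: embedding_dim_def A_def M(2)[unfolded A_def])
    then have n_le: "n \<le> embedding_dim c k d s"
      using n by (simp add: le_nat_floor)
    obtain x l where sys: "lagrange_system (Fd (d * m)) n x l"
      and l: "\<And>i t. i < n \<Longrightarrow> \<bar>apply_bcontfun (l i) t\<bar> \<le> 1"
      using fekete_system[OF compact sub finite_dim] unfolding n_def by metis
    have lower: "norm f \<le> root m (real n) * norm (sample n x f)" if f: "f \<in> Fd d" for f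
      using power_in_filtration[OF filtered constants f, of m] norm_le_sample[OF sys l _ _ m] by blast
    have inj: "inj_on (sample n x) (Fd d)"
    proof (rule inj_onI)
      fix f g assume fg: "f \<in> Fd d" "g \<in> Fd d" "sample n x f = sample n x g"
      have "sample n x (f - g) = sample n x f - sample n x g"
        by (rule bcontfun_eqI) (simp add: apply_sample)
      then show "f = g"
        using lower[OF subspace_diff[OF sub fg(1,2)]] fg(3) by simp
    qed
    have "banach_mazur_dist (Fd d) (sample n x ` Fd d) \<le> root m (real n)"
      using m by (intro banach_mazur_dist_le[OF sub finite_dim linear_map_on_sample inj norm_sample_le lower])
        simp_all
    also have "\<dots> \<le> (exp 1 * real s powr k) powr (1 / real s)"
      unfolding m_def
      using A1 M \<open>s \<ge> 3\<close> \<open>k \<ge> 0\<close> n dim_pos[of "d * m"]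
      by (intro dimension_root_bound[of A]) (auto simp: n_def)
    finally show ?thesis
      using inj linear_map_on_sample sample_in_linf[OF n_le] by blast
  qed
  then show ?thesis by metis
qed

end
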